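(* Let $G$ and $P$ be parallel straight lines in $\mathbb{R}^2$ such that $G$ does not contain $(0,0)$, and let $\varepsilon\in\mathbb{R}$. Choose a point $(\hat x,\hat y)$ on $G$ with $\hat y\neq 0$, put $S:=(\hat x-\varepsilon,\hat y)$ and $T:=(\hat x+\varepsilon,\hat y)$, and assume that neither the line through $(0,0)$ and $S$ nor the line through $(0,0)$ and $T$ is parallel to $G$ and $P$. Let $\overline{S}$ be the projection of $S$ on $P$ and $\overline{T}$ the projection of $T$ on $P$, i.e. $\overline{S},\overline{T}\in P$, the points $(0,0),S,\overline{S}$ are collinear, and the points $(0,0),T,\overline{T}$ are collinear. The four points $\overline{S},\overline{T},-\overline{S},-\overline{T}$ are the corners of a (possibly degenerate) parallelogram. Let $\nu$ be the intersection of the line through $\overline{T}$ and $-\overline{S}$ with the horizontal $x$-axis. Then: (A) If $P$ and $G$ are parallel to the vertical $y$-axis, then $\nu$ depends only on $\varepsilon$ and on the intersections of the $x$-axis with $G$ and with $P$. That is, any two configurations $(G,P,\varepsilon,(\hat x,\hat y))$ (each consisting of parallel straight lines $G,P$ with $(0,0)\notin G$, a real number $\varepsilon$, and a point $(\hat x,\hat y)\in G$ with $\hat y\neq 0$ such that neither the line through $(0,0)$ and $(\hat x-\varepsilon,\hat y)$ nor the line through $(0,0)$ and $(\hat x+\varepsilon,\hat y)$ is parallel to $G$ and $P$) with vertical $G,P$ that have the same $\varepsilon$, the same intersection point of $G$ with the $x$-axis and the same intersection point of $P$ with the $x$-axis have the same $\nu$. (B) If $P$ and $G$ are not parallel to the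 vertical $y$-axis, then $\nu$ depends only on $\varepsilon$ and on the intersections of the $y$-axis with $G$ and with $P$. That is, any two configurations $(G,P,\varepsilon,(\hat x,\hat y))$ (each consisting of parallel straight lines $G,P$ with $(0,0)\notin G$, a real number $\varepsilon$, and a point $(\hat x,\hat y)\in G$ with $\hat y\neq 0$ such that neither the line through $(0,0)$ and $(\hat x-\varepsilon,\hat y)$ nor the line through $(0,0)$ and $(\hat x+\varepsilon,\hat y)$ is parallel to $G$ and $P$) with non-vertical $G,P$ that have the same $\varepsilon$, the same intersection point of $G$ with the $y$-axis and the same intersection point of $P$ with the $y$-axis have the same $\nu$. In other words, $\nu$ does not depend on the choice of $(\hat x,\hat y)$ on $G$, and in case (B) it does not depend on the slope of $G$ and $P$ either.
   Context: $\mathbb{R}^2$ is the Euclidean plane with horizontal $x$-axis and vertical $y$-axis. Parallel lines are allowed to coincide. For a point $Q\in\mathbb{R}^2$, $-Q$ is its reflection in the origin. Convention for the degenerate case: if $P$ contains $(0,0)$, then $\overline{S}=\overline{T}=(0,0)$, the parallelogram collapses to the single point $(0,0)$, and $\nu:=(0,0)$. *)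

theory Defs
  imports "HOL-Analysis.Analysis"
begin

definition straight_line :: "(real \<times> real) set \<Rightarrow> bool" where
  "straight_line L \<longleftrightarrow> affine L \<and> aff_dim L = 1"

definition x_axis :: "(real \<times> real) set" where
  "x_axis = {p. snd p = 0}"

definition y_axis :: "(real \<times> real) set" where
  "y_axis = {p. fst p = 0}"

text \<open>Parallelism is \<^const>\<open>affine_parallel\<close>, so parallel lines may coincide.\<close>

definition vertical :: "(real \<times> real) set \<Rightarrow> bool" where
  "vertical L \<longleftrightarrow> affine_parallel L y_axis"

definition line_through :: "real \<times> real \<Rightarrow> real \<times> real \<Rightarrow> (real \<times> real) set" where
  "line_through A B = affine hull {A, B}"

text \<open>Corners in cyclic order; degenerate parallelograms are allowed.\<close>

definition parallelogram ::
    "real \<times> real \<Rightarrow> real \<times> real \<Rightarrow> real \<times> real \<Rightarrow> real \<times> real \<Rightarrow> bool" where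
  "parallelogram A B C D \<longleftrightarrow> B - A = C - D"

definition point_S :: "real \<Rightarrow> real \<times> real \<Rightarrow> real \<times> real" where
  "point_S \<epsilon> p = (fst p - \<epsilon>, snd p)"

definition point_T :: "real \<Rightarrow> real \<times> real \<Rightarrow> real \<times> real" where
  "point_T \<epsilon> p = (fst p + \<epsilon>, snd p)"

definition configuration ::
    "(real \<times> real) set \<Rightarrow> (real \<times> real) set \<Rightarrow> real \<Rightarrow> real \<times> real \<Rightarrow> bool" where
  "configuration G P \<epsilon> p \<longleftrightarrow>
     straight_line G \<and> straight_line P \<and> affine_parallel G P \<and> (0, 0) \<notin> G \<and>
     p \<in> G \<and> snd p \<noteq> 0 \<and>
     \<not> affine_parallel (line_through (0, 0) (point_S \<epsilon> p)) G \<and>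
     \<not> affine_parallel (line_through (0, 0) (point_S \<epsilon> p)) P \<and>
     \<not> affine_parallel (line_through (0, 0) (point_T \<epsilon> p)) G \<and>
     \<not> affine_parallel (line_through (0, 0) (point_T \<epsilon> p)) P"

definition is_projection :: "(real \<times> real) set \<Rightarrow> real \<times> real \<Rightarrow> real \<times> real \<Rightarrow> bool" where
  "is_projection P Q R \<longleftrightarrow> R \<in> P \<and> collinear {(0, 0), Q, R}"

definition projection :: "(real \<times> real) set \<Rightarrow> real \<times> real \<Rightarrow> real \<times> real" where
  "projection P Q = (THE R. is_projection P Q R)"

definition S_bar :: "(real \<times> real) set \<Rightarrow> real \<Rightarrow> real \<times> real \<Rightarrow> real \<times> real" where
  "S_bar P \<epsilon> p = projection P (point_S \<epsilon> p)"

definition T_bar :: "(real \<times> real) set \<Rightarrow> real \<Rightarrow> real \<times> real \<Rightarrow> real \<times> real" where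
  "T_bar P \<epsilon> p = projection P (point_T \<epsilon> p)"

text \<open>
  If \<open>P\<close> contains the origin, then \<open>T_bar\<close> and \<open>- S_bar\<close> coincide, so there is no line through
  them; the value is then the origin by convention.
\<close>

definition nu :: "(real \<times> real) set \<Rightarrow> real \<Rightarrow> real \<times> real \<Rightarrow> real \<times> real" where
  "nu P \<epsilon> p =
     (if (0, 0) \<in> P then (0, 0)
      else (THE v. v \<in> line_through (T_bar P \<epsilon> p) (- S_bar P \<epsilon> p) \<inter> x_axis))"

end

theory Submission
  imports Defs
begin

text \<open>
  Write the parallel lines with a common normal vector \<open>n\<close> as \<open>G = {q. n \<bullet> q = c}\<close> and
  \<open>P = {q. n \<bullet> q = d}\<close>, where \<open>c \<noteq> 0\<close> because \<open>G\<close> misses the origin. Central projection onto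
  \<open>P\<close> is scaling: a point \<open>Q\<close> with \<open>n \<bullet> Q \<noteq> 0\<close> goes to \<open>(d / (n \<bullet> Q)) Q\<close>. Hence
  \<open>(n \<bullet> T) T\<^sub>b + (n \<bullet> S) (- S\<^sub>b) = d (T - S) = (2 d \<epsilon>, 0)\<close>
  for the projections \<open>S\<^sub>b\<close> and \<open>T\<^sub>b\<close>, and the weights on the left add up to
  \<open>n \<bullet> (S + T) = 2 c\<close>, because the chosen point of \<open>G\<close> is the midpoint of \<open>S\<close> and \<open>T\<close>. After
  division by \<open>2 c\<close> this is an affine combination of \<open>T\<^sub>b\<close> and \<open>- S\<^sub>b\<close> that lies on the
  \<open>x\<close>-axis, so \<open>\<nu> = (\<epsilon> d / c, 0)\<close> (lemma \<open>nu_eq_offset_ratio\<close>). The formula holds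
  also for \<open>d = 0\<close>, where it gives the conventional value.

  The chosen point has disappeared, and \<open>d / c\<close> is the ratio of the intercepts that \<open>P\<close> and
  \<open>G\<close> have on any line through the origin that is not parallel to them: the \<open>x\<close>-axis when they are vertical, the
  \<open>y\<close>-axis otherwise. So the intercepts of \<open>G\<close> and \<open>P\<close> determine \<open>\<nu>\<close>.
\<close>

section \<open>Lines as level sets of a normal vector\<close>

text \<open>In the plane a line through the origin orthogonal to \<open>n\<close> fills out the whole kernel of
  \<open>n \<bullet> _\<close> by a dimension count, and every level set of \<open>n \<bullet> _\<close> is a translate of that kernel.
  This turns the hypotheses on non-parallelism into the statement that one may divide by
  \<open>n \<bullet> Q\<close>.\<close>

lemma line_through_origin_parallel_level_line:
  fixes n Q :: "real \<times> real"
  assumes "n \<noteq> 0" "Q \<noteq> 0" "n \<bullet> Q = 0"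
  shows "affine_parallel (line_through (0, 0) Q) {q. n \<bullet> q = c}"
proof -
  have "line_through (0, 0) Q \<subseteq> {q. n \<bullet> q = 0}"
    unfolding line_through_def
    by (rule hull_minimal) (use assms in \<open>auto simp: zero_prod_def[symmetric] affine_hyperplane\<close>)
  moreover have "aff_dim (line_through (0, 0) Q) = aff_dim {q. n \<bullet> q = 0}"
    using assms by (simp add: line_through_def aff_dim_2 zero_prod_def[symmetric])
  moreover have "line_through (0, 0) Q \<noteq> {}"
    by (simp add: line_through_def)
  ultimately have kernel: "line_through (0, 0) Q = {q. n \<bullet> q = 0}"
    by (intro affine_dim_equal) (auto simp: line_through_def affine_hyperplane)
  have "{q. n \<bullet> q = c} = (+) ((c / (n \<bullet> n)) *\<^sub>R n) ` {q. n \<bullet> q = 0}"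
  proof (intro set_eqI iffI)
    fix q assume "q \<in> {q. n \<bullet> q = c}"
    then show "q \<in> (+) ((c / (n \<bullet> n)) *\<^sub>R n) ` {q. n \<bullet> q = 0}"
      using assms(1)
      by (intro image_eqI[of _ _ "q - (c / (n \<bullet> n)) *\<^sub>R n"]) (auto simp: inner_diff_right)
  qed (use assms(1) in \<open>auto simp: inner_add_right\<close>)
  then show ?thesis
    unfolding kernel affine_parallel_def by blast
qed

lemma straight_line_level_set:
  assumes "straight_line L"
  obtains n c where "n \<noteq> 0" "L = {q. n \<bullet> q = c}"
proof -
  have hull: "affine hull L = L" and dim: "aff_dim L = int (DIM(real \<times> real) - 1)"
    using assms by (simp_all add: straight_line_def)
  obtain n c where "n \<noteq> 0" "L = {q. n \<bullet> q = c}"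
    using iffD1[OF aff_dim_eq_hyperplane dim, unfolded hull] by (elim exE conjE)
  then show ?thesis
    by (rule that)
qed

lemma parallel_level_set:
  assumes "affine_parallel {q. n \<bullet> q = c} P"
  obtains d where "P = {q. n \<bullet> q = d}"
proof -
  obtain v where v: "P = (+) v ` {q. n \<bullet> q = c}"
    using assms by (auto simp: affine_parallel_def)
  have "P = {q. n \<bullet> q = c + n \<bullet> v}"
  proof (intro set_eqI iffI)
    fix q assume "q \<in> {q. n \<bullet> q = c + n \<bullet> v}"
    then show "q \<in> P"
      unfolding v by (intro image_eqI[of _ _ "q - v"]) (auto simp: inner_diff_right)
  qed (auto simp: v inner_add_right)
  then show ?thesis using that by blast
qed

lemma vertical_level_set_iff:
  assumes "n \<noteq> 0"
  shows "vertical {q. n \<bullet> q = c} \<longleftrightarrow> snd n = 0"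
proof
  assume "vertical {q. n \<bullet> q = c}"
  then obtain v where "(+) v ` {q. n \<bullet> q = c} = y_axis"
    by (auto simp: vertical_def affine_parallel_def)
  \<comment> \<open>Two points of the \<open>y\<close>-axis, pulled back to the level set, differ by \<open>(0, 1)\<close>.\<close>
  then have "(0, 0) \<in> (+) v ` {q. n \<bullet> q = c}" "(0, 1) \<in> (+) v ` {q. n \<bullet> q = c}"
    by (auto simp: y_axis_def)
  then obtain q r where qr: "n \<bullet> q = c" "n \<bullet> r = c" "(0, 0) = v + q" "(0, 1) = v + r"
    unfolding image_iff by blast
  then have "(v + r) - (v + q) = (0, 1)"
    by (metis diff_zero zero_prod_def)
  then have "r - q = (0, 1)"
    by simp
  moreover have "n \<bullet> (r - q) = 0"
    using qr by (simp add: inner_diff_right)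
  ultimately have "n \<bullet> (0, 1) = 0"
    by simp
  then show "snd n = 0"
    by (simp add: inner_prod_def)
next
  assume "snd n = 0"
  then have "n \<bullet> (0, 1) = 0"
    by (simp add: inner_prod_def)
  moreover have "line_through (0, 0) (0, 1) = y_axis"
    by (auto simp: line_through_def y_axis_def zero_prod_def[symmetric]
        affine_hull_span_0 hull_inc span_singleton image_iff prod_eq_iff)
  ultimately have "affine_parallel y_axis {q. n \<bullet> q = c}"
    using line_through_origin_parallel_level_line[of n "(0, 1)" c] assms
    by (simp add: zero_prod_def)
  then show "vertical {q. n \<bullet> q = c}"
    by (simp add: vertical_def affine_parallel_commute)
qed

lemma configuration_normal_form:
  assumes "configuration G P \<epsilon> p"
  obtains n c d where "n \<noteq> 0" "c \<noteq> 0" "G = {q. n \<bullet> q = c}" "P = {q. n \<bullet> q = d}"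
    "n \<bullet> p = c" "snd p \<noteq> 0" "n \<bullet> point_S \<epsilon> p \<noteq> 0" "n \<bullet> point_T \<epsilon> p \<noteq> 0"
proof -
  note conf = assms[unfolded configuration_def]
  obtain n c where n: "n \<noteq> 0" and G: "G = {q. n \<bullet> q = c}"
    using conf straight_line_level_set by blast
  obtain d where P: "P = {q. n \<bullet> q = d}"
    using conf G parallel_level_set by blast
  have "c \<noteq> 0"
    using conf by (auto simp: G zero_prod_def[symmetric])
  moreover have "point_S \<epsilon> p \<noteq> 0" "point_T \<epsilon> p \<noteq> 0"
    using conf by (auto simp: point_S_def point_T_def prod_eq_iff)
  then have "n \<bullet> point_S \<epsilon> p \<noteq> 0" "n \<bullet> point_T \<epsilon> p \<noteq> 0"
    using conf n G line_through_origin_parallel_level_line by blast+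
  ultimately show ?thesis
    using that n G P conf by blast
qed

section \<open>Central projection and the point \<open>\<nu>\<close>\<close>

text \<open>The points collinear with the origin and \<open>Q\<close> are the multiples of \<open>Q\<close>, and \<open>n \<bullet> _\<close> picks
  out the multiple that lies on \<open>P\<close>.\<close>

lemma is_projection_level_line_iff:
  fixes n Q :: "real \<times> real"
  assumes "n \<bullet> Q \<noteq> 0"
  shows "is_projection {q. n \<bullet> q = d} Q R \<longleftrightarrow> R = (d / (n \<bullet> Q)) *\<^sub>R Q"
proof
  assume "is_projection {q. n \<bullet> q = d} Q R"
  then have R: "n \<bullet> R = d" and "collinear {0, Q, R}"
    by (auto simp: is_projection_def zero_prod_def)
  moreover have "Q \<noteq> 0"
    using assms by auto
  ultimately obtain k where k: "R = k *\<^sub>R Q"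
    using collinear_lemma[of Q R] by (metis scaleR_zero_left)
  with R assms have "k = d / (n \<bullet> Q)"
    by (auto simp: field_simps)
  with k show "R = (d / (n \<bullet> Q)) *\<^sub>R Q"
    by simp
next
  assume "R = (d / (n \<bullet> Q)) *\<^sub>R Q"
  then show "is_projection {q. n \<bullet> q = d} Q R"
    using assms
    by (auto simp: is_projection_def zero_prod_def[symmetric] collinear_lemma)
qed

lemma projection_level_line:
  fixes n Q :: "real \<times> real"
  assumes "n \<bullet> Q \<noteq> 0"
  shows "projection {q. n \<bullet> q = d} Q = (d / (n \<bullet> Q)) *\<^sub>R Q"
  using assms by (simp add: projection_def is_projection_level_line_iff)

lemma inner_point_T_eq:
  "n \<bullet> point_T \<epsilon> p = 2 * (n \<bullet> p) - n \<bullet> point_S \<epsilon> p"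
  by (simp add: point_S_def point_T_def inner_prod_def algebra_simps)

lemma line_through_meets_x_axis_once:
  assumes "snd A \<noteq> snd B"
    and "v \<in> line_through A B \<inter> x_axis" "w \<in> line_through A B \<inter> x_axis"
  shows "v = w"
proof -
  have coord: "\<exists>t. q = A + t *\<^sub>R (B - A) \<and> snd A + t * (snd B - snd A) = 0"
    if "q \<in> line_through A B \<inter> x_axis" for q
  proof -
    from that obtain u t where "q = u *\<^sub>R A + t *\<^sub>R B" "u + t = 1" "snd q = 0"
      by (auto simp: line_through_def affine_hull_2 x_axis_def)
    moreover from this have u: "u = 1 - t"
      by simp
    ultimately have q: "q = A + t *\<^sub>R (B - A)"
      by (simp add: algebra_simps)
    with \<open>snd q = 0\<close> have "snd A + t * (snd B - snd A) = 0"
      by simp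
    with q show ?thesis
      by blast
  qed
  obtain t s where "v = A + t *\<^sub>R (B - A)" "snd A + t * (snd B - snd A) = 0"
    "w = A + s *\<^sub>R (B - A)" "snd A + s * (snd B - snd A) = 0"
    using coord assms by meson
  moreover from this have "t * (snd B - snd A) = s * (snd B - snd A)"
    by linarith
  ultimately show ?thesis
    using assms(1) by simp
qed

text \<open>The difference of the ordinates is \<open>d y (1 / (n \<bullet> T) + 1 / (n \<bullet> S))\<close> for the common
  ordinate \<open>y\<close> of \<open>S\<close> and \<open>T\<close>, and the sum in brackets is \<open>2 c / ((n \<bullet> S) (n \<bullet> T))\<close>. So the
  line through the two points is well defined and not horizontal.\<close>

lemma snd_T_bar_neq_snd_minus_S_bar:
  assumes "n \<bullet> point_S \<epsilon> p \<noteq> 0" "n \<bullet> point_T \<epsilon> p \<noteq> 0" "n \<bullet> p \<noteq> 0" "snd p \<noteq> 0" "d \<noteq> 0"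
  shows "snd (T_bar {q. n \<bullet> q = d} \<epsilon> p) \<noteq> snd (- S_bar {q. n \<bullet> q = d} \<epsilon> p)"
proof
  let ?s = "n \<bullet> point_S \<epsilon> p" and ?t = "n \<bullet> point_T \<epsilon> p"
  assume "snd (T_bar {q. n \<bullet> q = d} \<epsilon> p) = snd (- S_bar {q. n \<bullet> q = d} \<epsilon> p)"
  then have "d / ?t * snd p = - (d / ?s * snd p)"
    using assms by (simp add: S_bar_def T_bar_def projection_level_line)
      (simp add: point_S_def point_T_def)
  then have "d * snd p * (?s + ?t) = 0"
    using assms(1,2) by (simp add: field_simps)
  moreover have "?s + ?t = 2 * (n \<bullet> p)"
    by (simp add: inner_point_T_eq)
  ultimately show False
    using assms by simp
qed

lemma offset_ratio_mem_line_through: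
  assumes "n \<bullet> point_S \<epsilon> p \<noteq> 0" "n \<bullet> point_T \<epsilon> p \<noteq> 0" "n \<bullet> p = c" "c \<noteq> 0"
  shows "(\<epsilon> * d / c, 0) \<in>
    line_through (T_bar {q. n \<bullet> q = d} \<epsilon> p) (- S_bar {q. n \<bullet> q = d} \<epsilon> p) \<inter> x_axis"
proof -
  let ?s = "n \<bullet> point_S \<epsilon> p" and ?t = "n \<bullet> point_T \<epsilon> p"
  \<comment> \<open>These weights sum to 1 and cancel the denominators of the two projections.\<close>
  have T: "(?t / (2 * c)) *\<^sub>R T_bar {q. n \<bullet> q = d} \<epsilon> p = (d / (2 * c)) *\<^sub>R point_T \<epsilon> p"
    and S: "(?s / (2 * c)) *\<^sub>R (- S_bar {q. n \<bullet> q = d} \<epsilon> p) = - (d / (2 * c)) *\<^sub>R point_S \<epsilon> p"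
    using assms by (simp_all add: S_bar_def T_bar_def projection_level_line)
  have "(?t / (2 * c)) *\<^sub>R T_bar {q. n \<bullet> q = d} \<epsilon> p
      + (?s / (2 * c)) *\<^sub>R (- S_bar {q. n \<bullet> q = d} \<epsilon> p) = (\<epsilon> * d / c, 0)"
    unfolding T S using assms(4)
    by (simp add: point_S_def point_T_def prod_eq_iff field_simps)
  moreover have "?t / (2 * c) + ?s / (2 * c) = 1"
    using assms by (simp add: inner_point_T_eq add_divide_distrib[symmetric])
  ultimately show ?thesis
    unfolding line_through_def affine_hull_2 x_axis_def
    by (smt (verit) IntI mem_Collect_eq snd_conv)
qed

lemma nu_eq_offset_ratio:
  assumes "n \<bullet> point_S \<epsilon> p \<noteq> 0" "n \<bullet> point_T \<epsilon> p \<noteq> 0" "n \<bullet> p = c" "c \<noteq> 0" "snd p \<noteq> 0"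
  shows "nu {q. n \<bullet> q = d} \<epsilon> p = (\<epsilon> * (d / c), 0)"
proof (cases "d = 0")
  case True
  then show ?thesis
    by (simp add: nu_def zero_prod_def[symmetric])
next
  case False
  then have "snd (T_bar {q. n \<bullet> q = d} \<epsilon> p) \<noteq> snd (- S_bar {q. n \<bullet> q = d} \<epsilon> p)"
    using assms by (intro snd_T_bar_neq_snd_minus_S_bar) auto
  then have "(THE v. v \<in> line_through (T_bar {q. n \<bullet> q = d} \<epsilon> p)
      (- S_bar {q. n \<bullet> q = d} \<epsilon> p) \<inter> x_axis) = (\<epsilon> * d / c, 0)"
    using line_through_meets_x_axis_once offset_ratio_mem_line_through[OF assms(1-4)]
    by (blast intro: the_equality)
  with False show ?thesis
    by (simp add: nu_def zero_prod_def[symmetric])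
qed

section \<open>Dependence on the intercepts\<close>

text \<open>A level line \<open>n \<bullet> q = c\<close> meets the line spanned by a transversal vector \<open>u\<close> in
  \<open>(c / (n \<bullet> u)) u\<close>. Equal traces of two such lines therefore give equal quotients
  \<open>c / (n \<bullet> u)\<close>, which is how the intercepts enter for either axis.\<close>

lemma intercept_eq:
  fixes u :: "real \<times> real"
  assumes "n \<bullet> u \<noteq> 0" "n' \<bullet> u \<noteq> 0" "range (\<lambda>k. k *\<^sub>R u) = X"
    and "{q. n \<bullet> q = c} \<inter> X = {q. n' \<bullet> q = c'} \<inter> X"
  shows "c / (n \<bullet> u) = c' / (n' \<bullet> u)"
proof -
  have "(c / (n \<bullet> u)) *\<^sub>R u \<in> {q. n \<bullet> q = c} \<inter> X"
    using assms(1,3) by auto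
  then have "n' \<bullet> ((c / (n \<bullet> u)) *\<^sub>R u) = c'"
    using assms(4) by blast
  then show ?thesis
    using assms(1,2) by (auto simp: field_simps)
qed

lemma offset_ratio_eq:
  fixes u :: "real \<times> real"
  assumes "n \<bullet> u \<noteq> 0" "n' \<bullet> u \<noteq> 0" "range (\<lambda>k. k *\<^sub>R u) = X"
    and "{q. n \<bullet> q = c} \<inter> X = {q. n' \<bullet> q = c'} \<inter> X"
    and "{q. n \<bullet> q = d} \<inter> X = {q. n' \<bullet> q = d'} \<inter> X"
  shows "d / c = d' / c'"
proof -
  have "d / c = (d / (n \<bullet> u)) / (c / (n \<bullet> u))"
    using assms(1) by simp
  also have "\<dots> = (d' / (n' \<bullet> u)) / (c' / (n' \<bullet> u))"
    using intercept_eq[OF assms(1-3,4)] intercept_eq[OF assms(1-3,5)] by simp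
  also have "\<dots> = d' / c'"
    using assms(2) by simp
  finally show ?thesis .
qed

lemma range_scaleR_x_axis: "range (\<lambda>k. k *\<^sub>R (1, 0)) = x_axis"
  by (auto simp: x_axis_def image_iff prod_eq_iff)

lemma range_scaleR_y_axis: "range (\<lambda>k. k *\<^sub>R (0, 1)) = y_axis"
  by (auto simp: y_axis_def image_iff prod_eq_iff)

text \<open>Here \<open>X\<close> is to be either axis, which treats the vertical and the non-vertical case alike.
  Transversality is asked for all representations as level sets, because a configuration does
  not come with a chosen normal vector.\<close>

lemma nu_determined_by_intercepts:
  assumes "configuration G P \<epsilon> p" "configuration G' P' \<epsilon> p'"
    and "G \<inter> X = G' \<inter> X" "P \<inter> X = P' \<inter> X" "range (\<lambda>k. k *\<^sub>R u) = X"
    and transversal: "\<And>n c. n \<noteq> 0 \<Longrightarrow> G = {q. n \<bullet> q = c} \<or> G' = {q. n \<bullet> q = c} \<Longrightarrow> n \<bullet> u \<noteq> 0"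
  shows "nu P \<epsilon> p = nu P' \<epsilon> p'"
proof -
  obtain n c d where n: "n \<noteq> 0" "c \<noteq> 0" "G = {q. n \<bullet> q = c}" "P = {q. n \<bullet> q = d}"
    "n \<bullet> p = c" "snd p \<noteq> 0" "n \<bullet> point_S \<epsilon> p \<noteq> 0" "n \<bullet> point_T \<epsilon> p \<noteq> 0"
    using configuration_normal_form[OF assms(1)] by metis
  obtain n' c' d' where n': "n' \<noteq> 0" "c' \<noteq> 0" "G' = {q. n' \<bullet> q = c'}" "P' = {q. n' \<bullet> q = d'}"
    "n' \<bullet> p' = c'" "snd p' \<noteq> 0" "n' \<bullet> point_S \<epsilon> p' \<noteq> 0" "n' \<bullet> point_T \<epsilon> p' \<noteq> 0"
    using configuration_normal_form[OF assms(2)] by metis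
  have "d / c = d' / c'"
  proof (rule offset_ratio_eq)
    show "n \<bullet> u \<noteq> 0" "n' \<bullet> u \<noteq> 0"
      using transversal n(1,3) n'(1,3) by blast+
  qed (use assms(3-5) n(3,4) n'(3,4) in auto)
  then show ?thesis
    using n n' by (simp add: nu_eq_offset_ratio)
qed

lemma projections_of_configuration:
  assumes "configuration G P \<epsilon> p"
  shows "(\<exists>!R. is_projection P (point_S \<epsilon> p) R) \<and>
      (\<exists>!R. is_projection P (point_T \<epsilon> p) R) \<and>
      parallelogram (S_bar P \<epsilon> p) (T_bar P \<epsilon> p) (- S_bar P \<epsilon> p) (- T_bar P \<epsilon> p) \<and>
      ((0, 0) \<in> P \<longrightarrow> S_bar P \<epsilon> p = (0, 0) \<and> T_bar P \<epsilon> p = (0, 0)) \<and>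
      ((0, 0) \<notin> P \<longrightarrow>
         T_bar P \<epsilon> p \<noteq> - S_bar P \<epsilon> p \<and>
         (\<exists>!v. v \<in> line_through (T_bar P \<epsilon> p) (- S_bar P \<epsilon> p) \<inter> x_axis))"
proof -
  obtain n c d where n: "c \<noteq> 0" "n \<bullet> p = c" "snd p \<noteq> 0"
    "n \<bullet> point_S \<epsilon> p \<noteq> 0" "n \<bullet> point_T \<epsilon> p \<noteq> 0" and P: "P = {q. n \<bullet> q = d}"
    using configuration_normal_form[OF assms] by metis
  have origin: "(0, 0) \<in> P \<longleftrightarrow> d = 0"
    by (auto simp: P zero_prod_def[symmetric])
  have "\<exists>!R. is_projection P (point_S \<epsilon> p) R" "\<exists>!R. is_projection P (point_T \<epsilon> p) R"
    using n by (simp_all add: P is_projection_level_line_iff)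
  moreover have "parallelogram (S_bar P \<epsilon> p) (T_bar P \<epsilon> p) (- S_bar P \<epsilon> p) (- T_bar P \<epsilon> p)"
    by (simp add: parallelogram_def)
  moreover have "S_bar P \<epsilon> p = (0, 0) \<and> T_bar P \<epsilon> p = (0, 0)" if "(0, 0) \<in> P"
    using that n origin
    by (simp add: P S_bar_def T_bar_def projection_level_line zero_prod_def)
  moreover have "T_bar P \<epsilon> p \<noteq> - S_bar P \<epsilon> p \<and>
      (\<exists>!v. v \<in> line_through (T_bar P \<epsilon> p) (- S_bar P \<epsilon> p) \<inter> x_axis)" if "(0, 0) \<notin> P"
  proof -
    have ordinates: "snd (T_bar P \<epsilon> p) \<noteq> snd (- S_bar P \<epsilon> p)"
      unfolding P by (rule snd_T_bar_neq_snd_minus_S_bar) (use n that origin in auto)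
    moreover have "(\<epsilon> * d / c, 0) \<in> line_through (T_bar P \<epsilon> p) (- S_bar P \<epsilon> p) \<inter> x_axis"
      unfolding P by (rule offset_ratio_mem_line_through) (use n in auto)
    ultimately show ?thesis
      using line_through_meets_x_axis_once[OF ordinates] by metis
  qed
  ultimately show ?thesis
    by blast
qed

theorem proposition3:
  "(\<forall>G P \<epsilon> p. configuration G P \<epsilon> p \<longrightarrow>
      (\<exists>!R. is_projection P (point_S \<epsilon> p) R) \<and>
      (\<exists>!R. is_projection P (point_T \<epsilon> p) R) \<and>
      parallelogram (S_bar P \<epsilon> p) (T_bar P \<epsilon> p) (- S_bar P \<epsilon> p) (- T_bar P \<epsilon> p) \<and>
      ((0, 0) \<in> P \<longrightarrow> S_bar P \<epsilon> p = (0, 0) \<and> T_bar P \<epsilon> p = (0, 0)) \<and>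
      ((0, 0) \<notin> P \<longrightarrow>
         T_bar P \<epsilon> p \<noteq> - S_bar P \<epsilon> p \<and>
         (\<exists>!v. v \<in> line_through (T_bar P \<epsilon> p) (- S_bar P \<epsilon> p) \<inter> x_axis))) \<and>
   (\<forall>G P G' P' \<epsilon> p p'.
      configuration G P \<epsilon> p \<and> configuration G' P' \<epsilon> p' \<and>
      vertical G \<and> vertical P \<and> vertical G' \<and> vertical P' \<and>
      G \<inter> x_axis = G' \<inter> x_axis \<and> P \<inter> x_axis = P' \<inter> x_axis \<longrightarrow>
      nu P \<epsilon> p = nu P' \<epsilon> p') \<and>
   (\<forall>G P G' P' \<epsilon> p p'.
      configuration G P \<epsilon> p \<and> configuration G' P' \<epsilon> p' \<and>
      \<not> vertical G \<and> \<not> vertical P \<and> \<not> vertical G' \<and> \<not> vertical P' \<and>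
      G \<inter> y_axis = G' \<inter> y_axis \<and> P \<inter> y_axis = P' \<inter> y_axis \<longrightarrow>
      nu P \<epsilon> p = nu P' \<epsilon> p')"
proof (rule conjI[OF _ conjI]; intro allI impI)
  fix G P :: "(real \<times> real) set" and \<epsilon> p
  assume "configuration G P \<epsilon> p"
  then show "(\<exists>!R. is_projection P (point_S \<epsilon> p) R) \<and>
      (\<exists>!R. is_projection P (point_T \<epsilon> p) R) \<and>
      parallelogram (S_bar P \<epsilon> p) (T_bar P \<epsilon> p) (- S_bar P \<epsilon> p) (- T_bar P \<epsilon> p) \<and>
      ((0, 0) \<in> P \<longrightarrow> S_bar P \<epsilon> p = (0, 0) \<and> T_bar P \<epsilon> p = (0, 0)) \<and>
      ((0, 0) \<notin> P \<longrightarrow>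
         T_bar P \<epsilon> p \<noteq> - S_bar P \<epsilon> p \<and>
         (\<exists>!v. v \<in> line_through (T_bar P \<epsilon> p) (- S_bar P \<epsilon> p) \<inter> x_axis))"
    by (rule projections_of_configuration)
next
  fix G P G' P' :: "(real \<times> real) set" and \<epsilon> p p'
  assume A: "configuration G P \<epsilon> p \<and> configuration G' P' \<epsilon> p' \<and>
      vertical G \<and> vertical P \<and> vertical G' \<and> vertical P' \<and>
      G \<inter> x_axis = G' \<inter> x_axis \<and> P \<inter> x_axis = P' \<inter> x_axis"
  have "n \<bullet> (1, 0) \<noteq> 0" if "n \<noteq> 0" "G = {q. n \<bullet> q = c} \<or> G' = {q. n \<bullet> q = c}" for n c
    using A that vertical_level_set_iff[OF that(1), of c]
    by (auto simp: inner_prod_def prod_eq_iff)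
  then show "nu P \<epsilon> p = nu P' \<epsilon> p'"
    using A nu_determined_by_intercepts[OF _ _ _ _ range_scaleR_x_axis, of G P \<epsilon> p G' P' p']
    by blast
next
  fix G P G' P' :: "(real \<times> real) set" and \<epsilon> p p'
  assume B: "configuration G P \<epsilon> p \<and> configuration G' P' \<epsilon> p' \<and>
      \<not> vertical G \<and> \<not> vertical P \<and> \<not> vertical G' \<and> \<not> vertical P' \<and>
      G \<inter> y_axis = G' \<inter> y_axis \<and> P \<inter> y_axis = P' \<inter> y_axis"
  have "n \<bullet> (0, 1) \<noteq> 0" if "n \<noteq> 0" "G = {q. n \<bullet> q = c} \<or> G' = {q. n \<bullet> q = c}" for n c
    using B that vertical_level_set_iff[OF that(1), of c]
    by (auto simp: inner_prod_def)
  then show "nu P \<epsilon> p = nu P' \<epsilon> p'"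
    using B nu_determined_by_intercepts[OF _ _ _ _ range_scaleR_y_axis, of G P \<epsilon> p G' P' p']
    by blast
qed

end
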